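(* Assume that the linear operators $\overline{R}:V\to\overline{V}$ and $\overline{P}:\overline{V}\to V$ satisfy $$\overline{R}\mathcal{F}(\mathbf{u})=\overline{R}\mathcal{F}(\overline{P}\,\overline{R}\mathbf{u})=\overline{\mathcal{F}}(\overline{R}\mathbf{u})\qquad\text{for all }\mathbf{u}\in V.$$ Given an initial guess $\mathbf{u}^0\in V$ and its substructured restriction $\mathbf{v}^0:=\overline{R}\mathbf{u}^0\in\overline{V}$, define the Newton sequences $\{\mathbf{u}^n\}$ and $\{\mathbf{v}^n\}$ by $$\mathbf{u}^n=\mathbf{u}^{n-1}-\bigl(J_{\mathcal{F}}(\mathbf{u}^{n-1})\bigr)^{-1}\mathcal{F}(\mathbf{u}^{n-1}),\qquad \mathbf{v}^n=\mathbf{v}^{n-1}-\bigl(J_{\overline{\mathcal{F}}}(\mathbf{v}^{n-1})\bigr)^{-1}\overline{\mathcal{F}}(\mathbf{v}^{n-1}),\qquad n\ge1,$$ where the Jacobians are assumed to be invertible at the iterates so that both sequences are well defined. Then $\overline{R}\mathbf{u}^n=\mathbf{v}^n$ for every $n\ge1$.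
   Context: Let $V\cong\mathbb{R}^{N_v}$ and let $F:V\to V$ be a (nonlinear) function. Let $\mathcal{J}=\{1,\dots,N\}$, and for each $j\in\mathcal{J}$ let $V_j$ be a finite-dimensional real vector space with linear maps $R_j:V\to V_j$, $P_j:V_j\to V$, $\widetilde{P}_j:V_j\to V$ satisfying $R_jP_j=I_{V_j}$ for every $j$ and $\sum_{j\in\mathcal{J}}\widetilde{P}_jR_j=I$ (identities on $V_j$ and $V$). The local solution operators $G_j:V\to V_j$ are defined through $$R_jF\bigl(P_jG_j(\mathbf{u})+(I-P_jR_j)\mathbf{u}\bigr)=0,\qquad \mathbf{u}\in V,$$ and are assumed well defined and differentiable. Let $\overline{V}\cong\mathbb{R}^{\overline{N}}$ (degrees of freedom on the substructure), with linear maps $\overline{R}:V\to\overline{V}$ and $\overline{P}:\overline{V}\to V$ satisfying $\overline{R}\,\overline{P}=\overline{I}$, the identity on $\overline{V}$. The RASPEN function $\mathcal{F}:V\to V$ and the SRASPEN function $\overline{\mathcal{F}}:\overline{V}\to\overline{V}$ are $$\mathcal{F}(\mathbf{u}):=\mathbf{u}-\sum_{j\in\mathcal{J}}\widetilde{P}_jG_j(\mathbf{u}),\qquad \overline{\mathcal{F}}(\mathbf{v}):=\mathbf{v}-\sum_{j\in\mathcal{J}}\overline{R}\,\widetilde{P}_jG_j(\overline{P}\mathbf{v})=\overline{R}\mathcal{F}(\overline{P}\mathbf{v}).$$ $J_{\mathcal{F}}$ and $J_{\overline{\mathcal{F}}}$ denote the Jacobians of $\mathcal{F}$ and $\overline{\mathcal{F}}$.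 *)

theory Defs
  imports "HOL-Analysis.Analysis"
begin

(* The local spaces are subspaces W j of one ambient Euclidean space, since their dimensions
   may vary with the index j.  Maps out of W j are total functions on the ambient space, and
   only their restrictions to W j matter. *)

definition linear_on_subspace ::
    "'w::real_vector set \<Rightarrow> ('w \<Rightarrow> 'v::real_vector) \<Rightarrow> bool" where
  "linear_on_subspace W f \<longleftrightarrow>
     (\<forall>x\<in>W. \<forall>y\<in>W. f (x + y) = f x + f y) \<and>
     (\<forall>c. \<forall>x\<in>W. f (c *\<^sub>R x) = c *\<^sub>R f x)"

definition solves_local ::
    "('v::real_vector \<Rightarrow> 'v) \<Rightarrow> ('v \<Rightarrow> 'w::real_vector) \<Rightarrow> ('w \<Rightarrow> 'v) \<Rightarrow> 'v \<Rightarrow> 'w \<Rightarrow> bool" where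
  "solves_local F Rj Pj u w \<longleftrightarrow> Rj (F (Pj w + (u - Pj (Rj u)))) = 0"

(* Meaningful only if the local problem has exactly one solution in Wj. *)
definition local_solution ::
    "('v::real_vector \<Rightarrow> 'v) \<Rightarrow> 'w::real_vector set \<Rightarrow> ('v \<Rightarrow> 'w) \<Rightarrow> ('w \<Rightarrow> 'v) \<Rightarrow> 'v \<Rightarrow> 'w" where
  "local_solution F Wj Rj Pj u = (THE w. w \<in> Wj \<and> solves_local F Rj Pj u w)"

definition raspen ::
    "nat \<Rightarrow> (nat \<Rightarrow> 'w \<Rightarrow> 'v::real_vector) \<Rightarrow> (nat \<Rightarrow> 'v \<Rightarrow> 'w) \<Rightarrow> 'v \<Rightarrow> 'v" where
  "raspen N Pt G u = u - (\<Sum>j=1..N. Pt j (G j u))"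

definition sraspen ::
    "nat \<Rightarrow> ('v::real_vector \<Rightarrow> 's::real_vector) \<Rightarrow> ('s \<Rightarrow> 'v) \<Rightarrow>
     (nat \<Rightarrow> 'w \<Rightarrow> 'v) \<Rightarrow> (nat \<Rightarrow> 'v \<Rightarrow> 'w) \<Rightarrow> 's \<Rightarrow> 's" where
  "sraspen N Rbar Pbar Pt G v = v - (\<Sum>j=1..N. Rbar (Pt j (G j (Pbar v))))"

end

(* Differentiating the intertwining relation Rbar o F = Fbar o Rbar gives
   Rbar (J_F(u) h) = J_Fbar(Rbar u) (Rbar h).  Hence Rbar maps the Newton correction
   J_F(u)^-1 F(u) to a solution k of J_Fbar(Rbar u) k = Fbar(Rbar u), which is unique,
   and Newton steps commute with Rbar. *)
theory Submission
  imports Defs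
begin

text \<open>A map that is linear only on \<open>W\<close> may be arbitrary, even discontinuous,
  elsewhere, so it cannot enter a chain rule on the ambient space. Prescribing its values on a basis
  of \<open>W\<close> yields a globally linear substitute.\<close>

lemma linear_on_subspace_extend:
  fixes f :: "'w::real_vector \<Rightarrow> 'v::real_vector"
  assumes "subspace W" "linear_on_subspace W f"
  obtains g where "linear g" "\<And>w. w \<in> W \<Longrightarrow> g w = f w"
proof -
  obtain B where B: "B \<subseteq> W" "independent B" "W \<subseteq> span B"
    using maximal_independent_subset by blast
  obtain g where g: "linear g" "\<And>b. b \<in> B \<Longrightarrow> g b = f b"
    using linear_independent_extend[OF B(2)] by blast
  have f: "f (x + y) = f x + f y" "f (c *\<^sub>R x) = c *\<^sub>R f x"
    if "x \<in> W" "y \<in> W" for c x y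
    using assms(2) that unfolding linear_on_subspace_def by auto
  \<comment> \<open>Membership in \<open>W\<close> is carried through the induction because
    \<open>f\<close> is known to be additive and homogeneous only there.\<close>
  have "w \<in> W \<and> g w = f w" if "w \<in> span B" for w
    using that
  proof (induction rule: span_induct_alt)
    case base
    show ?case
      using f(2)[of 0 0 0] subspace_0[OF assms(1)] linear_0[OF g(1)] by simp
  next
    case (step c x y)
    have "x \<in> W" "y \<in> W" "c *\<^sub>R x \<in> W"
      using step B(1) assms(1) by (auto intro: subspace_scale)
    then show ?case
      using step g f assms(1) by (simp add: linear_add linear_scale subspace_add)
  qed
  then show thesis
    using that[OF g(1)] B(3) by blast
qed

lemma
  fixes A :: "'a::semiring_1 ^ 'n ^ 'm"
  assumes "invertible A"
  shows matrix_inv_right: "A ** matrix_inv A = mat 1"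
    and matrix_inv_left: "matrix_inv A ** A = mat 1"
  using someI_ex[OF assms[unfolded invertible_def]] by (simp_all add: matrix_inv_def)

lemma matrix_inv_mult_eqI:
  fixes A :: "real ^ 'm ^ 'm"
  assumes "invertible A" "A *v x = y"
  shows "matrix_inv A *v y = x"
proof -
  have "matrix_inv A *v y = (matrix_inv A ** A) *v x"
    by (simp add: assms(2)[symmetric] matrix_vector_mul_assoc)
  then show ?thesis
    using assms(1) by (simp add: matrix_inv_left)
qed

lemma newton_step_semiconjugate:
  fixes f :: "real ^ 'n \<Rightarrow> real ^ 'n" and g :: "real ^ 'm \<Rightarrow> real ^ 'm"
    and L :: "real ^ 'n \<Rightarrow> real ^ 'm"
  assumes L: "linear L"
    and conj: "\<And>x. L (f x) = g (L x)"
    and f: "f differentiable (at a)"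
    and g: "g differentiable (at (L a))"
    and inv_f: "invertible (jacobian f (at a))"
    and inv_g: "invertible (jacobian g (at (L a)))"
  shows "L (a - matrix_inv (jacobian f (at a)) *v f a)
           = L a - matrix_inv (jacobian g (at (L a))) *v g (L a)"
proof -
  define h where "h = matrix_inv (jacobian f (at a)) *v f a"
  have bl: "bounded_linear L"
    using L by (simp add: linear_conv_bounded_linear)
  \<comment> \<open>One function, differentiated in two ways: here as \<open>L\<close> after
    \<open>f\<close>, and in \<open>dg\<close> as \<open>g\<close> after \<open>L\<close>.\<close>
  have df: "((\<lambda>x. L (f x)) has_derivative (\<lambda>k. L (jacobian f (at a) *v k))) (at a)"
    using f unfolding jacobian_works by (rule bounded_linear.has_derivative[OF bl])
  have "((g \<circ> L) has_derivative ((\<lambda>k. jacobian g (at (L a)) *v k) \<circ> L)) (at a)"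
    using g unfolding jacobian_works
    by (intro diff_chain_at bounded_linear_imp_has_derivative bl)
  then have dg: "((\<lambda>x. L (f x)) has_derivative (\<lambda>k. jacobian g (at (L a)) *v L k)) (at a)"
    by (simp add: conj o_def)
  \<comment> \<open>The two derivatives agree in every direction. The direction \<open>h\<close> is
    chosen because \<open>jacobian f (at a)\<close> sends it to \<open>f a\<close>, so that the
    right-hand side becomes \<open>L (f a)\<close>, which is \<open>g (L a)\<close>.\<close>
  have "jacobian g (at (L a)) *v L h = L (jacobian f (at a) *v h)"
    using has_derivative_unique[OF df dg] by metis
  also have "jacobian f (at a) *v h = f a"
    using inv_f by (simp add: h_def matrix_vector_mul_assoc matrix_inv_right)
  finally have "matrix_inv (jacobian g (at (L a))) *v g (L a) = L h"
    using inv_g by (intro matrix_inv_mult_eqI) (simp_all add: conj)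
  then show ?thesis
    using L by (simp add: h_def linear_diff)
qed

text \<open>Each \<open>Pt j\<close> is replaced by a linear map \<open>Q\<close> that agrees with
  it on \<open>W j\<close>. Since \<open>G j\<close> takes all its values in \<open>W j\<close>, the
  composite is unchanged, and it is differentiable because \<open>Q\<close> is bounded
  linear.\<close>

lemma raspen_differentiable:
  fixes G :: "nat \<Rightarrow> 'v::real_normed_vector \<Rightarrow> 'w::euclidean_space"
  assumes W: "\<And>j. j \<in> {1..N} \<Longrightarrow> subspace (W j)"
    and Pt: "\<And>j. j \<in> {1..N} \<Longrightarrow> linear_on_subspace (W j) (Pt j)"
    and G_into: "\<And>j x. j \<in> {1..N} \<Longrightarrow> G j x \<in> W j"
    and G: "\<And>j. j \<in> {1..N} \<Longrightarrow> G j differentiable (at x)"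
  shows "raspen N Pt G differentiable (at x)"
proof -
  have "(\<lambda>y. Pt j (G j y)) differentiable (at x)" if j: "j \<in> {1..N}" for j
  proof -
    obtain Q where Q: "linear Q" "\<And>w. w \<in> W j \<Longrightarrow> Q w = Pt j w"
      using linear_on_subspace_extend[OF W[OF j] Pt[OF j]] by blast
    have "(\<lambda>y. Q (G j y)) differentiable (at x)"
      using bounded_linear.has_derivative[OF Q(1)[unfolded linear_conv_bounded_linear]] G[OF j]
      unfolding differentiable_def by blast
    then show ?thesis
      by (simp add: Q(2) G_into[OF j])
  qed
  then have "(\<lambda>y. y - (\<Sum>j=1..N. Pt j (G j y))) differentiable (at x)"
    by (intro differentiable_diff differentiable_ident differentiable_sum) auto
  then show ?thesis
    by (simp add: raspen_def[abs_def])
qed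

theorem theorem4p2:
  fixes F :: "real ^ 'n \<Rightarrow> real ^ 'n"
    and N :: nat
    and W :: "nat \<Rightarrow> 'w::euclidean_space set"
    and R :: "nat \<Rightarrow> real ^ 'n \<Rightarrow> 'w"
    and P Pt :: "nat \<Rightarrow> 'w \<Rightarrow> real ^ 'n"
    and G :: "nat \<Rightarrow> real ^ 'n \<Rightarrow> 'w"
    and Rbar :: "real ^ 'n \<Rightarrow> real ^ 'm"
    and Pbar :: "real ^ 'm \<Rightarrow> real ^ 'n"
    and \<F> :: "real ^ 'n \<Rightarrow> real ^ 'n"
    and \<F>bar :: "real ^ 'm \<Rightarrow> real ^ 'm"
    and u :: "nat \<Rightarrow> real ^ 'n"
    and v :: "nat \<Rightarrow> real ^ 'm"
    and u0 :: "real ^ 'n"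
  defines "G \<equiv> \<lambda>j. local_solution F (W j) (R j) (P j)"
    and "\<F> \<equiv> raspen N Pt G"
    and "\<F>bar \<equiv> sraspen N Rbar Pbar Pt G"
  assumes W_subspace: "\<And>j. j \<in> {1..N} \<Longrightarrow> subspace (W j)"
    and R_linear: "\<And>j. j \<in> {1..N} \<Longrightarrow> linear (R j)"
    and R_into: "\<And>j x. j \<in> {1..N} \<Longrightarrow> R j x \<in> W j"
    and P_linear: "\<And>j. j \<in> {1..N} \<Longrightarrow> linear_on_subspace (W j) (P j)"
    and Pt_linear: "\<And>j. j \<in> {1..N} \<Longrightarrow> linear_on_subspace (W j) (Pt j)"
    and RP_id: "\<And>j w. j \<in> {1..N} \<Longrightarrow> w \<in> W j \<Longrightarrow> R j (P j w) = w"
    and partition: "\<And>x. (\<Sum>j=1..N. Pt j (R j x)) = x"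
    and G_well_defined:
      "\<And>j x. j \<in> {1..N} \<Longrightarrow> \<exists>!w. w \<in> W j \<and> solves_local F (R j) (P j) x w"
    and G_differentiable: "\<And>j x. j \<in> {1..N} \<Longrightarrow> G j differentiable (at x)"
    and Rbar_linear: "linear Rbar"
    and Pbar_linear: "linear Pbar"
    and RbarPbar_id: "\<And>y. Rbar (Pbar y) = y"
    and compat: "\<And>x. Rbar (\<F> x) = Rbar (\<F> (Pbar (Rbar x))) \<and>
                     Rbar (\<F> (Pbar (Rbar x))) = \<F>bar (Rbar x)"
    and u_init: "u 0 = u0"
    and v_init: "v 0 = Rbar u0"
    and u_invertible: "\<And>n. n \<ge> 1 \<Longrightarrow> invertible (jacobian \<F> (at (u (n - 1))))"
    and v_invertible: "\<And>n. n \<ge> 1 \<Longrightarrow> invertible (jacobian \<F>bar (at (v (n - 1))))"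
    and u_newton: "\<And>n. n \<ge> 1 \<Longrightarrow>
      u n = u (n - 1) - matrix_inv (jacobian \<F> (at (u (n - 1)))) *v \<F> (u (n - 1))"
    and v_newton: "\<And>n. n \<ge> 1 \<Longrightarrow>
      v n = v (n - 1) - matrix_inv (jacobian \<F>bar (at (v (n - 1)))) *v \<F>bar (v (n - 1))"
  shows "\<forall>n\<ge>1. Rbar (u n) = v n"
proof -
  \<comment> \<open>The definite description in \<open>local_solution\<close> satisfies its defining
    property only by unique solvability of the local problem.\<close>
  have G_into: "G j x \<in> W j" if "j \<in> {1..N}" for j x
    using theI'[OF G_well_defined[OF that, of x]] by (simp add: G_def local_solution_def)
  have \<F>_diff: "\<F> differentiable (at x)" for x
    unfolding \<F>_def using W_subspace Pt_linear G_into G_differentiable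
    by (rule raspen_differentiable)
  have semiconj: "Rbar (\<F> x) = \<F>bar (Rbar x)" for x
    using compat[of x] by simp
  \<comment> \<open>Evaluating the compatibility relation at \<open>Pbar y\<close> and cancelling
    \<open>Rbar (Pbar y) = y\<close> expresses \<open>\<F>bar\<close> through \<open>\<F>\<close>,
    from which it inherits differentiability.\<close>
  have "\<F>bar = (\<lambda>y. Rbar (\<F> (Pbar y)))"
    by (simp add: semiconj RbarPbar_id)
  moreover have "(\<lambda>y. Rbar (\<F> (Pbar y))) differentiable (at y)" for y
    using differentiable_chain_at[OF differentiable_chain_at[OF
        linear_imp_differentiable[OF Pbar_linear] \<F>_diff]
        linear_imp_differentiable[OF Rbar_linear], of y]
    by (simp add: o_def)
  ultimately have \<F>bar_diff: "\<F>bar differentiable (at y)" for y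
    by simp
  \<comment> \<open>The claim is extended to index 0, where it is the choice of the initial guess
    and starts the induction.\<close>
  have "Rbar (u n) = v n" for n
  proof (induction n)
    case 0
    show ?case by (simp add: u_init v_init)
  next
    case (Suc n)
    \<comment> \<open>The induction hypothesis identifies \<open>Rbar (u n)\<close> with
      \<open>v n\<close>, which is where the Jacobian of \<open>\<F>bar\<close> is assumed
      invertible. Instantiating the hypotheses at \<open>Suc n\<close> turns their index
      \<open>n - 1\<close> into \<open>n\<close>.\<close>
    have "Rbar (u n - matrix_inv (jacobian \<F> (at (u n))) *v \<F> (u n))
        = Rbar (u n) - matrix_inv (jacobian \<F>bar (at (Rbar (u n)))) *v \<F>bar (Rbar (u n))"
      using u_invertible[of "Suc n"] v_invertible[of "Suc n"]
      by (intro newton_step_semiconjugate Rbar_linear \<F>_diff \<F>bar_diff)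
        (simp_all add: Suc semiconj)
    then show ?case
      using u_newton[of "Suc n"] v_newton[of "Suc n"] by (simp add: Suc)
  qed
  then show ?thesis by blast
qed

end
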